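(* Let $\Sigma$ be a connected and unbalanced signed graph, and let $U$ be an edge subset of $\Sigma$. Then $U$ is a bond of $\Sigma$ if and only if $U$ is the support of an elementary integer-valued tension of $\Sigma$.
   Context: A graph $(V,E)$ has finite vertex set $V$ and finite edge set $E$ (multiple edges allowed); each edge has two ends, each end is attached to one vertex or to none, and at least one end is attached to a vertex. A loop has both ends at the same vertex, a link has its ends at two distinct vertices, an outer-edge has exactly one end attached to a vertex. A signed graph $\Sigma=(V,E,\sigma)$ is a graph with a sign function $\sigma:E\to\{1,-1\}$. A circle is a connected 2-regular signed (sub)graph without outer-edges (a loop with its vertex is a circle); its sign is the product of its edge signs. A signed graph is balanced if it has no outer-edges and all its circles are positive; otherwise it is unbalanced. $\Sigma\setminus S$ denotes deletion of the edges in $S$ (vertices are kept). Arcs and chains. Each edge $e$ has exactly two orientations $\vec e$ and $\vec e^{\,-1}$: an orientation puts an arrow on each of the two ends of $e$, the two arrows having the same direction along $e$ if $e$ is positive and opposite directions if $e$ is negative; $\vec e^{\,-1}$ reverses both arrows. $\vec E$ is the set of all such arcs. The incidence number $[v,\vec e\,]$ is $1$ (resp. $-1$) if $\vec e$ is a non-loop arc at $v$ whose arrow at $v$ points to (resp. away from) $v$; $2$ (resp. $-2$) if $\vec e$ is a negative loop at $v$ pointing to (resp. away from) $v$; and $0$ otherwise. A 1-chain over an abelian group $\mathbb A$ is a function ${\bf c}:\vec E\to\mathbb A$ with ${\bf c}(\vec e^{\,-1})=-{\bf c}(\vec e\,)$; its support is $\{e\in E:{\bf c}(\vec e\,)\ne0\}$.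 It is a flow if $\sum_{e\in E}[v,\vec e\,]{\bf c}(\vec e\,)=0$ for all $v\in V$ (one orientation chosen for each edge; the choice is irrelevant). A tension over $\mathbb A$ is a 1-chain ${\bf g}$ over $\mathbb A$ with $\sum_{e\in E}{\bf f}(\vec e\,){\bf g}(\vec e\,)=0$ for all integer-valued flows ${\bf f}$. An integer-valued tension is elementary if it is nonzero and its support is minimal (under inclusion) among supports of nonzero tensions (in the real tension space of $\Sigma$). Cuts and bonds. For nonempty $X\subseteq V$: $X^c=V\setminus X$; $O_X$ is the set of outer-edges with endpoint in $X$; $[X,X^c]$ is the set of links between $X$ and $X^c$; $\Sigma[X]$ is the signed subgraph with vertex set $X$ and all loops and links having all endpoints in $X$. A switching on $X$ is a function $\nu:V\to\{1,-1\}$ with $\nu=1$ on $X^c$; $\Sigma^\nu$ has sign $\sigma^\nu(e)=\nu(u)\sigma(e)\nu(v)$ for a loop or link $e=uv$, and $\nu(u)\sigma(e)$ for an outer-edge at $u$. Put $\delta X^\nu:=[X,X^c]\cup E_X\cup O_X$, where $E_X$ is the set of edges of $\Sigma[X]$ that are negative in $\Sigma^\nu$. A cut is a nonempty edge subset $U=\delta X^\nu$ ($X$ nonempty, $\nu$ a switching on $X$) such that $\Sigma[X]\setminus U$ is balanced, the edges of $\Sigma[X]$ in $U$ are negative in $\Sigma^\nu$, the edges of $\Sigma[X]$ not in $U$ are positive in $\Sigma^\nu$, and $(\Sigma[X]\setminus U)\cup e$ is unbalanced for each edge $e$ of $\Sigma[X]$ in $U$. A bond is a cut that properly contains no cut as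 an edge subset. *)

theory Defs
  imports Complex_Main
begin

section \<open>Signed graphs\<close>

datatype edge_end = End1 | End2

text \<open>Each end of an edge is attached to one vertex (\<open>Some v\<close>) or to none (\<open>None\<close>).\<close>

record ('v, 'e) sgraph =
  verts :: "'v set"
  edges :: "'e set"
  attach :: "'e \<Rightarrow> edge_end \<Rightarrow> 'v option"
  esign :: "'e \<Rightarrow> int"

definition endpoints :: "('v, 'e) sgraph \<Rightarrow> 'e \<Rightarrow> 'v set" where
  "endpoints G e = {v. \<exists>h. attach G e h = Some v}"

locale signed_graph =
  fixes G :: "('v, 'e) sgraph"
  assumes finite_verts: "finite (verts G)"
    and finite_edges: "finite (edges G)"
    and endpoints_in_verts: "\<And>e. e \<in> edges G \<Longrightarrow> endpoints G e \<subseteq> verts G"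
    and some_end_attached: "\<And>e. e \<in> edges G \<Longrightarrow> endpoints G e \<noteq> {}"
    and esign_cases: "\<And>e. e \<in> edges G \<Longrightarrow> esign G e \<in> {1, -1}"

definition is_loop :: "('v, 'e) sgraph \<Rightarrow> 'e \<Rightarrow> bool" where
  "is_loop G e \<longleftrightarrow> (\<exists>v. attach G e End1 = Some v \<and> attach G e End2 = Some v)"

definition is_link :: "('v, 'e) sgraph \<Rightarrow> 'e \<Rightarrow> bool" where
  "is_link G e \<longleftrightarrow> (\<exists>u v. attach G e End1 = Some u \<and> attach G e End2 = Some v \<and> u \<noteq> v)"

definition is_outer :: "('v, 'e) sgraph \<Rightarrow> 'e \<Rightarrow> bool" where
  "is_outer G e \<longleftrightarrow> (\<exists>!h. attach G e h \<noteq> None)"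

definition is_subgraph :: "('v, 'e) sgraph \<Rightarrow> ('v, 'e) sgraph \<Rightarrow> bool" where
  "is_subgraph H G \<longleftrightarrow>
     verts H \<subseteq> verts G \<and> edges H \<subseteq> edges G \<and> attach H = attach G \<and> esign H = esign G \<and>
     (\<forall>e\<in>edges H. endpoints G e \<subseteq> verts H)"

definition adj_rel :: "('v, 'e) sgraph \<Rightarrow> ('v \<times> 'v) set" where
  "adj_rel G = {(u, v). \<exists>e\<in>edges G. endpoints G e = {u, v}}"

definition sg_connected :: "('v, 'e) sgraph \<Rightarrow> bool" where
  "sg_connected G \<longleftrightarrow>
     verts G \<noteq> {} \<and> (\<forall>u\<in>verts G. \<forall>v\<in>verts G. (u, v) \<in> (adj_rel G)\<^sup>*)"

text \<open>The degree counts attached ends, so a loop contributes 2.\<close>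

definition sg_degree :: "('v, 'e) sgraph \<Rightarrow> 'v \<Rightarrow> nat" where
  "sg_degree G v = card {(e, h). e \<in> edges G \<and> attach G e h = Some v}"

definition is_circle :: "('v, 'e) sgraph \<Rightarrow> bool" where
  "is_circle C \<longleftrightarrow>
     sg_connected C \<and> (\<forall>v\<in>verts C. sg_degree C v = 2) \<and> (\<forall>e\<in>edges C. \<not> is_outer C e)"

definition balanced :: "('v, 'e) sgraph \<Rightarrow> bool" where
  "balanced G \<longleftrightarrow>
     (\<forall>e\<in>edges G. \<not> is_outer G e) \<and>
     (\<forall>C. is_subgraph C G \<and> is_circle C \<longrightarrow> (\<Prod>e\<in>edges C. esign C e) = 1)"

definition del_edges :: "('v, 'e) sgraph \<Rightarrow> 'e set \<Rightarrow> ('v, 'e) sgraph" where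
  "del_edges G S = G\<lparr>edges := edges G - S\<rparr>"

definition add_edge :: "('v, 'e) sgraph \<Rightarrow> 'e \<Rightarrow> ('v, 'e) sgraph" where
  "add_edge G e = G\<lparr>edges := insert e (edges G)\<rparr>"

section \<open>Arcs, chains, flows and tensions\<close>

text \<open>
  An arc is an edge with an arrow on each of its two ends. The arrow on an end has value 1 if
  it points along the edge towards that end (hence to the vertex attached there, if any), and
  -1 if it points away from it. The two arrows have the same direction along the edge iff these
  values are opposite, so positive edges have opposite values and negative edges equal values.
  Unattached ends carry arrows too.
\<close>

type_synonym 'e arc = "'e \<times> (edge_end \<Rightarrow> int)"

definition is_orientation :: "('v, 'e) sgraph \<Rightarrow> 'e \<Rightarrow> (edge_end \<Rightarrow> int) \<Rightarrow> bool" where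
  "is_orientation G e t \<longleftrightarrow>
     (\<forall>h. t h \<in> {1, -1}) \<and>
     (if esign G e = 1 then t End1 = - t End2 else t End1 = t End2)"

definition sg_arcs :: "('v, 'e) sgraph \<Rightarrow> 'e arc set" where
  "sg_arcs G = {(e, t). e \<in> edges G \<and> is_orientation G e t}"

fun arc_rev :: "'e arc \<Rightarrow> 'e arc" where
  "arc_rev (e, t) = (e, \<lambda>h. - t h)"

fun incidence :: "('v, 'e) sgraph \<Rightarrow> 'v \<Rightarrow> 'e arc \<Rightarrow> int" where
  "incidence G v (e, t) =
     (if attach G e End1 = Some v \<and> attach G e End2 = Some v
      then (if esign G e = -1 then 2 * t End1 else 0)
      else if attach G e End1 = Some v then t End1
      else if attach G e End2 = Some v then t End2
      else 0)"

text \<open>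
  Chains are total functions on pairs; only their values on \<open>sg_arcs G\<close> are meaningful. The
  coefficient groups needed are additive groups of rings, where the integer multiple
  \<open>n \<cdot> a\<close> is \<open>of_int n * a\<close>.
\<close>

definition is_chain :: "('v, 'e) sgraph \<Rightarrow> ('e arc \<Rightarrow> 'a::ring_1) \<Rightarrow> bool" where
  "is_chain G c \<longleftrightarrow> (\<forall>a\<in>sg_arcs G. c (arc_rev a) = - c a)"

definition chain_support :: "('v, 'e) sgraph \<Rightarrow> ('e arc \<Rightarrow> 'a::ring_1) \<Rightarrow> 'e set" where
  "chain_support G c = {e \<in> edges G. \<exists>t. is_orientation G e t \<and> c (e, t) \<noteq> 0}"

text \<open>A choice of one orientation for every edge.\<close>

definition is_edge_choice :: "('v, 'e) sgraph \<Rightarrow> ('e \<Rightarrow> edge_end \<Rightarrow> int) \<Rightarrow> bool" where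
  "is_edge_choice G w \<longleftrightarrow> (\<forall>e\<in>edges G. is_orientation G e (w e))"

text \<open>
  The sums below do not depend on the choice \<open>w\<close> (both factors change sign when an arc is
  reversed), and a choice always exists, so quantifying universally over \<open>w\<close> is harmless.
\<close>

definition is_flow :: "('v, 'e) sgraph \<Rightarrow> ('e arc \<Rightarrow> 'a::ring_1) \<Rightarrow> bool" where
  "is_flow G c \<longleftrightarrow> is_chain G c \<and>
     (\<forall>w. is_edge_choice G w \<longrightarrow>
        (\<forall>v\<in>verts G. (\<Sum>e\<in>edges G. of_int (incidence G v (e, w e)) * c (e, w e)) = 0))"

definition is_tension :: "('v, 'e) sgraph \<Rightarrow> ('e arc \<Rightarrow> 'a::ring_1) \<Rightarrow> bool" where
  "is_tension G g \<longleftrightarrow> is_chain G g \<and>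
     (\<forall>f :: 'e arc \<Rightarrow> int. is_flow G f \<longrightarrow>
        (\<forall>w. is_edge_choice G w \<longrightarrow>
           (\<Sum>e\<in>edges G. of_int (f (e, w e)) * g (e, w e)) = 0))"

definition nonzero_chain :: "('v, 'e) sgraph \<Rightarrow> ('e arc \<Rightarrow> 'a::ring_1) \<Rightarrow> bool" where
  "nonzero_chain G c \<longleftrightarrow> (\<exists>a\<in>sg_arcs G. c a \<noteq> 0)"

text \<open>Minimality is taken among supports of nonzero real tensions.\<close>

definition elementary_tension :: "('v, 'e) sgraph \<Rightarrow> ('e arc \<Rightarrow> int) \<Rightarrow> bool" where
  "elementary_tension G g \<longleftrightarrow> is_tension G g \<and> nonzero_chain G g \<and>
     (\<forall>g' :: 'e arc \<Rightarrow> real. is_tension G g' \<and> nonzero_chain G g' \<longrightarrow>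
        \<not> chain_support G g' \<subset> chain_support G g)"

section \<open>Switching, cuts and bonds\<close>

definition is_switching_on :: "('v, 'e) sgraph \<Rightarrow> 'v set \<Rightarrow> ('v \<Rightarrow> int) \<Rightarrow> bool" where
  "is_switching_on G X n \<longleftrightarrow>
     (\<forall>v\<in>verts G. n v \<in> {1, -1}) \<and> (\<forall>v\<in>verts G - X. n v = 1)"

definition switch_sign :: "('v, 'e) sgraph \<Rightarrow> ('v \<Rightarrow> int) \<Rightarrow> 'e \<Rightarrow> int" where
  "switch_sign G n e =
     (case (attach G e End1, attach G e End2) of
        (Some u, Some v) \<Rightarrow> n u * esign G e * n v
      | (Some u, None) \<Rightarrow> n u * esign G e
      | (None, Some v) \<Rightarrow> n v * esign G e
      | (None, None) \<Rightarrow> esign G e)"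

definition switch :: "('v, 'e) sgraph \<Rightarrow> ('v \<Rightarrow> int) \<Rightarrow> ('v, 'e) sgraph" where
  "switch G n = G\<lparr>esign := switch_sign G n\<rparr>"

definition induced :: "('v, 'e) sgraph \<Rightarrow> 'v set \<Rightarrow> ('v, 'e) sgraph" where
  "induced G X = G\<lparr>verts := X,
     edges := {e \<in> edges G. (is_loop G e \<or> is_link G e) \<and> endpoints G e \<subseteq> X}\<rparr>"

definition links_between :: "('v, 'e) sgraph \<Rightarrow> 'v set \<Rightarrow> 'v set \<Rightarrow> 'e set" where
  "links_between G X Y =
     {e \<in> edges G. is_link G e \<and> (\<exists>x\<in>X. \<exists>y\<in>Y. endpoints G e = {x, y})}"

definition outer_edges_at :: "('v, 'e) sgraph \<Rightarrow> 'v set \<Rightarrow> 'e set" where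
  "outer_edges_at G X = {e \<in> edges G. is_outer G e \<and> endpoints G e \<subseteq> X}"

definition cut_set :: "('v, 'e) sgraph \<Rightarrow> 'v set \<Rightarrow> ('v \<Rightarrow> int) \<Rightarrow> 'e set" where
  "cut_set G X n =
     links_between G X (verts G - X) \<union>
     {e \<in> edges (induced G X). esign (switch G n) e = -1} \<union>
     outer_edges_at G X"

definition is_cut :: "('v, 'e) sgraph \<Rightarrow> 'e set \<Rightarrow> bool" where
  "is_cut G U \<longleftrightarrow> U \<noteq> {} \<and>
     (\<exists>X n. X \<noteq> {} \<and> X \<subseteq> verts G \<and> is_switching_on G X n \<and> U = cut_set G X n \<and>
        balanced (del_edges (induced G X) U) \<and>
        (\<forall>e\<in>edges (induced G X) \<inter> U. esign (switch G n) e = -1) \<and>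
        (\<forall>e\<in>edges (induced G X) - U. esign (switch G n) e = 1) \<and>
        (\<forall>e\<in>edges (induced G X) \<inter> U.
           \<not> balanced (add_edge (del_edges (induced G X) U) e)))"

definition is_bond :: "('v, 'e) sgraph \<Rightarrow> 'e set \<Rightarrow> bool" where
  "is_bond G U \<longleftrightarrow> is_cut G U \<and> (\<forall>U'. is_cut G U' \<longrightarrow> \<not> U' \<subset> U)"

end

theory Submission
  imports Defs
begin

text \<open>
  A real tension is the coboundary of a vertex potential \<open>p\<close>: its value on an edge between \<open>u\<close>
  and \<open>v\<close> is, up to sign, \<open>p u - \<sigma> p v\<close>, and on an outer-edge at \<open>u\<close> it is \<open>p u\<close> up to sign.
  This is the statement that a vector orthogonal to all integer solutions of a system of linear
  equations with integer coefficients is a combination of the equations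
  (\<open>orthogonal_to_integer_kernel_imp_row_combination\<close>).

  Potentials tie cuts to tensions in both directions. If \<open>p\<close> is a switching \<open>\<nu>\<close> on \<open>X\<close> and zero off
  \<open>X\<close>, then \<open>p u - \<sigma> p v\<close> vanishes inside \<open>X\<close> exactly on the edges that \<open>\<nu>\<close> makes positive, so the
  support of the coboundary is \<open>\<delta>X\<^sup>\<nu>\<close> (\<open>cut_set_eq_coboundary_support\<close>): every cut supports a nonzero
  integer tension. Conversely (\<open>tension_support_contains_cut\<close>), let \<open>g\<close> be a nonzero tension with
  potential \<open>p\<close> and let \<open>v0\<close> be a vertex with \<open>p v0 \<noteq> 0\<close>. Along a link outside the support of \<open>g\<close>
  the absolute value of \<open>p\<close> does not change. Let \<open>X\<close> be the set of vertices reached from \<open>v0\<close>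
  through such links and \<open>\<nu>\<close> the sign of \<open>p\<close> on \<open>X\<close>. Then \<open>\<delta>X\<^sup>\<nu>\<close> lies in the support of \<open>g\<close>, and
  the edges of \<open>\<Sigma>[X]\<close> outside it connect \<open>X\<close> and are all positive after switching. Such a set is a
  cut (\<open>cut_set_is_cut\<close>): positivity after switching gives balance, and a further, negative edge
  closes up with a path in \<open>X\<close> to a negative circle. It is nonempty because \<open>\<Sigma>\<close> is connected (if
  \<open>X \<noteq> V\<close>) and unbalanced (if \<open>X = V\<close>).

  Hence every cut is the support of a nonzero integer tension, and the support of every nonzero
  real tension contains a cut. So the minimal cuts and the minimal supports coincide.
\<close>

section \<open>Integral orthogonality\<close>

text \<open>
  Gaussian elimination on the rows, one pivot at a time. Only integer solutions are available as
  test vectors, so each row operation clears denominators by scaling with the pivot entry instead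
  of dividing by it; division happens only in the field that contains the coefficients of the
  combination.
\<close>

lemma orthogonal_to_integer_kernel_imp_row_combination:
  fixes M :: "'v \<Rightarrow> 'e \<Rightarrow> int" and g :: "'e \<Rightarrow> 'a::field_char_0"
  assumes "finite V" "finite E"
    and "\<And>f :: 'e \<Rightarrow> int. (\<forall>v\<in>V. (\<Sum>e\<in>E. M v e * f e) = 0) \<Longrightarrow>
           (\<Sum>e\<in>E. of_int (f e) * g e) = 0"
  shows "\<exists>p. \<forall>e\<in>E. g e = (\<Sum>v\<in>V. of_int (M v e) * p v)"
  using assms
proof (induction V arbitrary: E M g rule: finite_induct)
  case empty
  have "g e = 0" if "e \<in> E" for e
  proof -
    have "(\<Sum>e'\<in>E. of_int (of_bool (e' = e)) * g e') = (0::'a)"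
      using empty.prems(2)[of "\<lambda>e'. of_bool (e' = e)"] by simp
    moreover have "(\<Sum>e'\<in>E. of_int (of_bool (e' = e)) * g e') = (\<Sum>e'\<in>E. if e' = e then g e' else 0)"
      by (rule sum.cong) auto
    ultimately show ?thesis using that empty.prems(1) by simp
  qed
  then show ?case by simp
next
  case (insert v V)
  show ?case
  proof (cases "\<exists>e0\<in>E. M v e0 \<noteq> 0")
    case False
    then have "\<exists>p. \<forall>e\<in>E. g e = (\<Sum>u\<in>V. of_int (M u e) * p u)"
      by (intro insert.IH insert.prems) auto
    then show ?thesis using False insert.hyps by auto
  next
    case True
    then obtain e0 where e0: "e0 \<in> E" and c0: "M v e0 \<noteq> 0" by auto
    define c where "c = M v e0"
    define E' where "E' = E - {e0}"
    define N where "N u e = c * M u e - M u e0 * M v e" for u e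
    define g' where "g' e = of_int c * g e - g e0 * of_int (M v e)" for e
    have split: "sum F E = F e0 + sum F E'" for F :: "'e \<Rightarrow> 'b::ab_group_add"
      unfolding E'_def using e0 insert.prems(1) by (simp add: sum.remove)
    have "\<exists>p. \<forall>e\<in>E'. g' e = (\<Sum>u\<in>V. of_int (N u e) * p u)"
    proof (rule insert.IH)
      show "finite E'" using insert.prems(1) by (simp add: E'_def)
      fix f :: "'e \<Rightarrow> int"
      assume f: "\<forall>u\<in>V. (\<Sum>e\<in>E'. N u e * f e) = 0"
      \<comment> \<open>A solution of the eliminated system extends to one of the full system: the value on
        the pivot edge is forced by row \<open>v\<close>, up to the factor \<open>c\<close> that avoids division.\<close>
      define s where "s = (\<Sum>e\<in>E'. M v e * f e)"
      define F where "F e = (if e = e0 then - s else c * f e)" for e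
      have FE': "F e = c * f e" if "e \<in> E'" for e using that by (auto simp: F_def E'_def)
      have "(\<Sum>e\<in>E. M u e * F e) = 0" if "u \<in> insert v V" for u
      proof -
        have "(\<Sum>e\<in>E. M u e * F e) = - M u e0 * s + (\<Sum>e\<in>E'. M u e * (c * f e))"
          by (simp add: split F_def FE' cong: sum.cong) (rule sum.cong, auto simp: E'_def)
        also have "\<dots> = (\<Sum>e\<in>E'. N u e * f e)"
          by (simp add: s_def N_def sum_distrib_left sum_negf[symmetric] sum.distrib[symmetric] algebra_simps
                flip: sum_subtractf)
        also have "\<dots> = 0"
          using f that by (auto simp: N_def c_def)
        finally show ?thesis .
      qed
      then have "(\<Sum>e\<in>E. of_int (F e) * g e) = 0" by (intro insert.prems(2)) auto
      moreover have "(\<Sum>e\<in>E. of_int (F e) * g e) =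
          - of_int s * g e0 + (\<Sum>e\<in>E'. of_int (c * f e) * g e)"
        unfolding split by (simp add: F_def) (rule sum.cong, auto simp: E'_def)
      moreover have "\<dots> = (\<Sum>e\<in>E'. of_int (f e) * g' e)"
        by (simp add: s_def g'_def of_int_sum sum_distrib_left sum_distrib_right
              sum_subtractf algebra_simps)
      ultimately show "(\<Sum>e\<in>E'. of_int (f e) * g' e) = 0" by simp
    qed
    then obtain p where p: "\<And>e. e \<in> E' \<Longrightarrow> g' e = (\<Sum>u\<in>V. of_int (N u e) * p u)" by auto
    have cn: "of_int c \<noteq> (0::'a)" using c0 by (simp add: c_def)
    \<comment> \<open>The coefficient of row \<open>v\<close> is chosen so that the combination is right on the pivot edge.\<close>
    define y where "y = (g e0 - (\<Sum>u\<in>V. of_int (M u e0) * p u)) / of_int c"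
    have cy: "of_int c * y = g e0 - (\<Sum>u\<in>V. of_int (M u e0) * p u)"
      using cn by (simp add: y_def)
    have "g e = (\<Sum>u\<in>insert v V. of_int (M u e) * (p(v := y)) u)" if "e \<in> E" for e
    proof -
      have rest: "(\<Sum>u\<in>V. of_int (M u e) * (p(v := y)) u) = (\<Sum>u\<in>V. of_int (M u e) * p u)"
        using insert.hyps by (intro sum.cong) auto
      have "of_int c * g e = of_int c * (of_int (M v e) * y + (\<Sum>u\<in>V. of_int (M u e) * p u))"
      proof (cases "e = e0")
        case True
        then show ?thesis using cn by (simp add: y_def c_def)
      next
        case False
        then have "of_int c * g e = g e0 * of_int (M v e) + (\<Sum>u\<in>V. of_int (N u e) * p u)"
          using p[of e] that by (simp add: E'_def g'_def algebra_simps)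
        also have "(\<Sum>u\<in>V. of_int (N u e) * p u) =
            of_int c * (\<Sum>u\<in>V. of_int (M u e) * p u) -
            of_int (M v e) * (\<Sum>u\<in>V. of_int (M u e0) * p u)"
          by (simp add: N_def sum_distrib_left algebra_simps flip: sum_subtractf)
        also have "g e0 * of_int (M v e) + \<dots> =
            of_int (M v e) * (of_int c * y) + of_int c * (\<Sum>u\<in>V. of_int (M u e) * p u)"
          unfolding cy by (simp add: algebra_simps)
        finally show ?thesis by (simp add: algebra_simps)
      qed
      then show ?thesis using cn rest insert.hyps by simp
    qed
    then show ?thesis by blast
  qed
qed

section \<open>Shortest paths\<close>

text \<open>A walk of minimal length repeats no vertex, as a repetition could be cut out.\<close>

lemma shortest_path:
  assumes "(u, v) \<in> R\<^sup>*"
  obtains f and k :: nat where "f 0 = u" "f k = v" "\<And>i. i < k \<Longrightarrow> (f i, f (Suc i)) \<in> R"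
    "inj_on f {..k}"
proof -
  define k where "k = (LEAST k. (u, v) \<in> R ^^ k)"
  have "(u, v) \<in> R ^^ k"
    unfolding k_def using assms by (metis LeastI rtrancl_imp_relpow)
  then obtain f where f: "f 0 = u" "f k = v" "\<And>i. i < k \<Longrightarrow> (f i, f (Suc i)) \<in> R"
    by (auto simp: relpow_fun_conv)
  have seg: "(f i, f (i + d)) \<in> R ^^ d" if "i + d \<le> k" for i d
    using that f(3) by (auto simp: relpow_fun_conv intro!: exI[of _ "\<lambda>j. f (i + j)"])
  have "f i \<noteq> f j" if "i < j" "j \<le> k" for i j
  proof
    assume eq: "f i = f j"
    have "(u, f i) \<in> R ^^ i" "(f i, v) \<in> R ^^ (k - j)"
      using seg[of 0 i] seg[of j "k - j"] that f eq by auto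
    then have "(u, v) \<in> R ^^ (i + (k - j))" by (metis relpow_add relcomp.relcompI)
    then have "k \<le> i + (k - j)" unfolding k_def by (rule Least_le)
    then show False using that by simp
  qed
  then have "inj_on f {..k}"
    by (intro inj_onI) (metis atMost_iff linorder_neqE_nat)
  then show ?thesis using f that by blast
qed

section \<open>Coboundaries\<close>

text \<open>
  A chain is determined by its values on one orientation of each edge. The reference orientation
  has its first arrow equal to 1, so that an arbitrary orientation \<open>t\<close> is \<open>t End1\<close> times it.
\<close>

definition std_orientation :: "('v, 'e) sgraph \<Rightarrow> 'e \<Rightarrow> edge_end \<Rightarrow> int" where
  "std_orientation G e h = (if h = End1 then 1 else - esign G e)"

definition coboundary :: "('v, 'e) sgraph \<Rightarrow> ('v \<Rightarrow> 'a) \<Rightarrow> 'e arc \<Rightarrow> 'a::ring_1" where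
  "coboundary G p a = (\<Sum>v\<in>verts G. of_int (incidence G v a) * p v)"

lemma all_edge_end: "(\<forall>h. P h) \<longleftrightarrow> P End1 \<and> P End2"
  by (metis edge_end.exhaust)

lemma ex_edge_end: "(\<exists>h. P h) \<longleftrightarrow> P End1 \<or> P End2"
  by (metis edge_end.exhaust)

lemma UNIV_edge_end: "UNIV = {End1, End2}"
  using edge_end.exhaust by auto

lemma endpoints_iff: "v \<in> endpoints G e \<longleftrightarrow> attach G e End1 = Some v \<or> attach G e End2 = Some v"
  by (simp add: endpoints_def ex_edge_end)

lemma incidence_arc_rev: "incidence G v (arc_rev a) = - incidence G v a"
  by (cases a) auto

lemma is_outer_iff:
  "is_outer G e \<longleftrightarrow> (attach G e End1 = None) \<noteq> (attach G e End2 = None)"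
  unfolding is_outer_def Ex1_def ex_edge_end all_edge_end by auto

text \<open>
  Exchanging the two summations turns the pairing of a coboundary with a flow into a combination
  of the conservation laws of the flow.
\<close>

lemma coboundary_is_tension: "is_tension G (coboundary G p)"
  unfolding is_tension_def is_chain_def
proof (intro conjI ballI allI impI)
  fix a show "coboundary G p (arc_rev a) = - coboundary G p a"
    by (simp add: coboundary_def incidence_arc_rev sum_negf)
next
  fix f :: "'b arc \<Rightarrow> int" and w
  assume f: "is_flow G f" and w: "is_edge_choice G w"
  have "(\<Sum>e\<in>edges G. of_int (f (e, w e)) * coboundary G p (e, w e)) =
      (\<Sum>e\<in>edges G. \<Sum>v\<in>verts G. of_int (incidence G v (e, w e) * f (e, w e)) * p v)"
    by (simp add: coboundary_def sum_distrib_left mult.assoc[symmetric] mult.commute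
          flip: of_int_mult)
  also have "\<dots> = (\<Sum>v\<in>verts G. of_int (\<Sum>e\<in>edges G. incidence G v (e, w e) * f (e, w e)) * p v)"
    by (subst sum.swap) (simp add: of_int_sum sum_distrib_right)
  also have "\<dots> = 0"
    using f w by (simp add: is_flow_def)
  finally show "(\<Sum>e\<in>edges G. of_int (f (e, w e)) * coboundary G p (e, w e)) = 0" .
qed

lemma nonzero_chain_iff_support:
  "nonzero_chain G c \<longleftrightarrow> chain_support G c \<noteq> {}"
  by (auto simp: nonzero_chain_def chain_support_def sg_arcs_def)

context signed_graph
begin

lemma std_orientation_is_orientation:
  "e \<in> edges G \<Longrightarrow> is_orientation G e (std_orientation G e)"
  using esign_cases[of e] by (auto simp: is_orientation_def std_orientation_def)

lemma orientation_eq_std: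
  assumes "e \<in> edges G" "is_orientation G e t"
  shows "t = std_orientation G e \<or> t = (\<lambda>h. - std_orientation G e h)"
  using assms esign_cases[of e]
  by (auto simp: is_orientation_def std_orientation_def fun_eq_iff all_edge_end split: if_splits)

lemma chain_value:
  assumes "is_chain G c" "e \<in> edges G" "is_orientation G e t"
  shows "c (e, t) = of_int (t End1) * c (e, std_orientation G e)"
  using orientation_eq_std[OF assms(2,3)]
proof
  assume t: "t = (\<lambda>h. - std_orientation G e h)"
  have "c (arc_rev (e, std_orientation G e)) = - c (e, std_orientation G e)"
    using assms std_orientation_is_orientation[OF assms(2)]
    unfolding is_chain_def sg_arcs_def by blast
  then show ?thesis using t by (simp add: std_orientation_def)
qed (simp add: std_orientation_def)

lemma chain_support_std:
  assumes "is_chain G c"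
  shows "chain_support G c = {e \<in> edges G. c (e, std_orientation G e) \<noteq> 0}"
proof -
  have "(\<exists>t. is_orientation G e t \<and> c (e, t) \<noteq> 0) \<longleftrightarrow> c (e, std_orientation G e) \<noteq> 0"
    if "e \<in> edges G" for e
    using chain_value[OF assms that] std_orientation_is_orientation[OF that]
    by (metis mult_zero_right)
  then show ?thesis by (auto simp: chain_support_def)
qed

lemma incidence_orientation:
  assumes "e \<in> edges G" "is_orientation G e t"
  shows "incidence G v (e, t) = t End1 * incidence G v (e, std_orientation G e)"
  using orientation_eq_std[OF assms]
  by (auto simp: std_orientation_def)

text \<open>
  Integer functions on the edges that satisfy the conservation laws for the reference orientation
  extend to flows on all arcs, so a tension is orthogonal to all of them and the elimination lemma
  applies to the incidence matrix.
\<close>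

lemma real_tension_is_coboundary:
  fixes g :: "'e arc \<Rightarrow> real"
  assumes "is_tension G g"
  shows "\<exists>p. \<forall>e\<in>edges G.
    g (e, std_orientation G e) = coboundary G p (e, std_orientation G e)"
proof -
  let ?w = "std_orientation G"
  have choice: "is_edge_choice G ?w"
    by (simp add: is_edge_choice_def std_orientation_is_orientation)
  have "\<exists>p. \<forall>e\<in>edges G. g (e, ?w e) =
      (\<Sum>v\<in>verts G. of_int (incidence G v (e, ?w e)) * p v)"
  proof (rule orthogonal_to_integer_kernel_imp_row_combination)
    fix f :: "'e \<Rightarrow> int"
    assume f: "\<forall>v\<in>verts G. (\<Sum>e\<in>edges G. incidence G v (e, ?w e) * f e) = 0"
    define c :: "'e arc \<Rightarrow> int" where "c = (\<lambda>(e, t). t End1 * f e)"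
    have "is_flow G c"
      unfolding is_flow_def
    proof (intro conjI allI impI ballI)
      show "is_chain G c" by (auto simp: is_chain_def c_def)
      fix w v assume w: "is_edge_choice G w" and v: "v \<in> verts G"
      have "(\<Sum>e\<in>edges G. of_int (incidence G v (e, w e)) * c (e, w e)) =
          (\<Sum>e\<in>edges G. incidence G v (e, ?w e) * f e)"
      proof (rule sum.cong[OF refl])
        fix e assume e: "e \<in> edges G"
        then have o: "is_orientation G e (w e)" using w by (simp add: is_edge_choice_def)
        then have "w e End1 = 1 \<or> w e End1 = -1" by (simp add: is_orientation_def all_edge_end)
        then show "of_int (incidence G v (e, w e)) * c (e, w e) =
            incidence G v (e, ?w e) * f e"
          unfolding incidence_orientation[OF e o] c_def by (elim disjE) simp_all
      qed
      then show "(\<Sum>e\<in>edges G. of_int (incidence G v (e, w e)) * c (e, w e)) = 0"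
        using f v by simp
    qed
    then have "(\<Sum>e\<in>edges G. of_int (c (e, ?w e)) * g (e, ?w e)) = 0"
      using assms choice by (simp add: is_tension_def)
    then show "(\<Sum>e\<in>edges G. of_int (f e) * g (e, ?w e)) = 0"
      by (simp add: c_def std_orientation_def)
  qed (simp_all add: finite_verts finite_edges)
  then show ?thesis by (simp add: coboundary_def)
qed

text \<open>
  The incidence number of a loop is the sum of the contributions of its two ends (\<open>2\<close> for a
  negative loop, \<open>0\<close> for a positive one), so one formula \<open>p u - \<sigma> p v\<close> covers loops and links, and
  an unattached end contributes \<open>0\<close>.
\<close>

lemma coboundary_std:
  assumes e: "e \<in> edges G"
  shows "coboundary G p (e, std_orientation G e) =
    (case attach G e End1 of None \<Rightarrow> 0 | Some u \<Rightarrow> p u) -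
    of_int (esign G e) * (case attach G e End2 of None \<Rightarrow> 0 | Some v \<Rightarrow> p v)"
proof -
  have ends: "v \<in> verts G" if "attach G e h = Some v" for h v
    using endpoints_in_verts[OF e] that by (auto simp: endpoints_def)
  have inc: "of_int (incidence G v (e, std_orientation G e)) * p v =
      (if attach G e End1 = Some v then p v else 0) -
      of_int (esign G e) * (if attach G e End2 = Some v then p v else 0)" for v
    using esign_cases[OF e] by (auto simp: std_orientation_def mult_2)
  have at: "(\<Sum>v\<in>verts G. if attach G e h = Some v then p v else 0) =
      (case attach G e h of None \<Rightarrow> 0 | Some u \<Rightarrow> p u)" for h
    using ends[of h] finite_verts by (auto split: option.splits)
  show ?thesis
    unfolding coboundary_def inc sum_subtractf sum_distrib_left[symmetric] at ..
qed

lemma edge_cases: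
  assumes "e \<in> edges G"
  obtains (ends) u v where "attach G e End1 = Some u" "attach G e End2 = Some v"
      "u \<in> verts G" "v \<in> verts G" "\<not> is_outer G e" "endpoints G e = {u, v}"
  | (outer) u where "is_outer G e" "endpoints G e = {u}" "u \<in> verts G"
      "attach G e End1 = Some u \<and> attach G e End2 = None \<or>
       attach G e End1 = None \<and> attach G e End2 = Some u"
proof -
  have "endpoints G e \<noteq> {}" "endpoints G e \<subseteq> verts G"
    using assms some_end_attached endpoints_in_verts by auto
  then show ?thesis
    using that
    by (cases "attach G e End1"; cases "attach G e End2")
       (auto simp: is_outer_iff endpoints_def ex_edge_end)
qed

section \<open>Switching and circles\<close>

text \<open>
  Switching does not change the sign of a circle: each vertex of the circle carries exactly two
  edge ends, so its factor \<open>n v\<close> enters the product squared.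
\<close>

lemma prod_switch_sign_circle:
  assumes C: "is_subgraph C G" "is_circle C"
    and n: "\<And>v. v \<in> verts G \<Longrightarrow> n v \<in> {1, -1}"
  shows "(\<Prod>e\<in>edges C. switch_sign G n e) = (\<Prod>e\<in>edges C. esign C e)"
proof -
  have sub: "edges C \<subseteq> edges G" "verts C \<subseteq> verts G" "attach C = attach G" "esign C = esign G"
    and ends: "\<And>e. e \<in> edges C \<Longrightarrow> endpoints G e \<subseteq> verts C"
    using C(1) by (auto simp: is_subgraph_def)
  have fin: "finite (edges C)" "finite (verts C)"
    using sub finite_edges finite_verts finite_subset by auto
  have att: "\<exists>v\<in>verts C. attach G e h = Some v" if e: "e \<in> edges C" for e h
  proof -
    have "e \<in> edges G" "\<not> is_outer G e"
      using C(2) e sub by (auto simp: is_circle_def is_outer_def)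
    then show ?thesis
      using ends[OF e] by (cases rule: edge_cases[of e]; cases h) auto
  qed
  let ?P = "edges C \<times> (UNIV :: edge_end set)"
  let ?at = "\<lambda>(e, h). the (attach G e h)"
  have "(\<Prod>e\<in>edges C. switch_sign G n e) =
      (\<Prod>e\<in>edges C. esign G e * (\<Prod>h\<in>UNIV. n (the (attach G e h))))"
  proof (rule prod.cong[OF refl])
    fix e assume "e \<in> edges C"
    then show "switch_sign G n e = esign G e * (\<Prod>h\<in>UNIV. n (the (attach G e h)))"
      using att[of e End1] att[of e End2] by (auto simp: switch_sign_def UNIV_edge_end)
  qed
  also have "\<dots> = (\<Prod>e\<in>edges C. esign G e) * (\<Prod>x\<in>?P. n (?at x))"
    by (simp add: prod.distrib prod.cartesian_product split_def)
  also have "(\<Prod>x\<in>?P. n (?at x)) = (\<Prod>v\<in>verts C. \<Prod>x\<in>{x\<in>?P. ?at x = v}. n (?at x))"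
  proof (rule prod.group[symmetric])
    show "finite ?P" using fin by (simp add: UNIV_edge_end)
    show "?at ` ?P \<subseteq> verts C"
    proof (clarify, simp)
      fix e h assume "e \<in> edges C"
      then show "the (attach G e h) \<in> verts C" using att[of e h] by auto
    qed
  qed (use fin in simp)
  also have "\<dots> = (\<Prod>v\<in>verts C. 1)"
  proof (rule prod.cong[OF refl])
    fix v assume v: "v \<in> verts C"
    have "{x\<in>?P. ?at x = v} = {(e, h). e \<in> edges C \<and> attach C e h = Some v}"
    proof (intro set_eqI iffI; clarify)
      fix e h assume "e \<in> edges C"
      then show "attach C e h = Some (the (attach G e h))" using att[of e h] sub by auto
    qed (simp add: sub)
    then have "card {x\<in>?P. ?at x = v} = 2"
      using C(2) v by (simp add: is_circle_def sg_degree_def)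
    then have "(\<Prod>x\<in>{x\<in>?P. ?at x = v}. n (?at x)) = n v ^ 2"
      by (subst prod.cong[OF refl, of _ _ "\<lambda>_. n v"]) auto
    also have "\<dots> = 1" using n[OF subsetD[OF sub(2) v]] by auto
    finally show "(\<Prod>x\<in>{x\<in>?P. ?at x = v}. n (?at x)) = 1" .
  qed
  finally show ?thesis using sub by simp
qed

lemma balanced_if_switched_positive:
  assumes "\<And>e. e \<in> edges G \<Longrightarrow> \<not> is_outer G e \<and> switch_sign G n e = 1"
    and "\<And>v. v \<in> verts G \<Longrightarrow> n v \<in> {1, -1}"
  shows "balanced G"
  unfolding balanced_def
proof (intro conjI ballI allI impI)
  fix C assume C: "is_subgraph C G \<and> is_circle C"
  then have "(\<Prod>e\<in>edges C. switch_sign G n e) = 1"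
    using assms(1) by (intro prod.neutral) (auto simp: is_subgraph_def)
  then show "(\<Prod>e\<in>edges C. esign C e) = 1"
    using prod_switch_sign_circle[of C n] C assms(2) by simp
qed (use assms in auto)

text \<open>
  A shortest path between the ends of \<open>e\<close> that avoids \<open>e\<close> is closed up by \<open>e\<close> to a circle. A loop
  \<open>e\<close> is the case of a path of length \<open>0\<close>: then \<open>e\<close> leads from position \<open>0\<close> to itself and both of its
  ends count towards the degree.
\<close>

lemma circle_through_edge:
  assumes e: "e \<in> edges G" "\<not> is_outer G e"
    and conn: "sg_connected (del_edges G {e})"
  obtains C where "is_subgraph C G" "is_circle C" "e \<in> edges C"
proof -
  obtain u v where uv: "attach G e End1 = Some u" "attach G e End2 = Some v"
      "u \<in> verts G" "v \<in> verts G" "endpoints G e = {u, v}"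
    using e by (cases rule: edge_cases[of e]) auto
  then have "(u, v) \<in> (adj_rel (del_edges G {e}))\<^sup>*"
    using conn by (simp add: sg_connected_def del_edges_def)
  then obtain f k where f: "f 0 = u" "f k = v" "inj_on f {..k}"
    and step: "\<And>i. i < k \<Longrightarrow> (f i, f (Suc i)) \<in> adj_rel (del_edges G {e})"
    by (rule shortest_path) blast
  have "\<exists>d. i < k \<longrightarrow> d \<in> edges G - {e} \<and> endpoints G d = {f i, f (Suc i)}" for i
    using step[of i] by (auto simp: adj_rel_def del_edges_def endpoints_def)
  then obtain d where d: "\<And>i. i < k \<Longrightarrow> d i \<in> edges G - {e} \<and> endpoints G (d i) = {f i, f (Suc i)}"
    by metis
  \<comment> \<open>Close the path up by \<open>e\<close>: cyclically, edge \<open>i\<close> joins position \<open>i\<close> to position \<open>nx i\<close>.\<close>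
  define nx where "nx i = (if i = k then 0 else Suc i)" for i
  define \<epsilon> where "\<epsilon> i = (if i = k then e else d i)" for i
  have ed: "\<epsilon> i \<in> edges G \<and> endpoints G (\<epsilon> i) = {f i, f (nx i)}" if "i \<le> k" for i
    using that d[of i] e uv f by (cases "i = k") (auto simp: \<epsilon>_def nx_def)
  have feq: "f i = f j \<longleftrightarrow> i = j" if "i \<le> k" "j \<le> k" for i j
    using f(3) that by (auto simp: inj_on_def)
  have inj: "inj_on \<epsilon> {..k}"
  proof (rule inj_onI)
    fix i j assume ij: "i \<in> {..k}" "j \<in> {..k}" and eq: "\<epsilon> i = \<epsilon> j"
    show "i = j"
    proof (cases "i = k \<or> j = k")
      case True
      then show ?thesis using eq d[of i] d[of j] ij
        by (metis DiffE atMost_iff \<epsilon>_def insertCI le_neq_implies_less)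
    next
      case False
      then have "{f i, f (Suc i)} = {f j, f (Suc j)}" "i < k" "j < k"
        using eq d[of i] d[of j] ij by (auto simp: \<epsilon>_def)
      then show ?thesis
        using feq[of i j] feq[of i "Suc j"] feq[of "Suc i" j] by (auto simp: doubleton_eq_iff)
    qed
  qed
  have noouter: "\<not> is_outer G (\<epsilon> i)" if "i \<le> k" for i
  proof (cases "i = k")
    case False
    then have "\<epsilon> i \<in> edges G" "endpoints G (\<epsilon> i) = {f i, f (Suc i)}" "f i \<noteq> f (Suc i)"
      using ed[of i] feq[of i "Suc i"] that by (auto simp: nx_def)
    then show ?thesis
      by (cases rule: edge_cases[of "\<epsilon> i"]) auto
  qed (use e in \<open>simp add: \<epsilon>_def\<close>)
  define C where "C = G\<lparr>verts := f ` {..k}, edges := \<epsilon> ` {..k}\<rparr>"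
  have nxk: "nx i \<le> k" if "i \<le> k" for i using that by (auto simp: nx_def)
  have fv: "f i \<in> verts G" if "i \<le> k" for i
    using ed[OF that] endpoints_in_verts[of "\<epsilon> i"] by auto
  have sub: "is_subgraph C G"
    unfolding is_subgraph_def C_def using ed fv nxk by auto
  have "sg_degree C w = 2" if "w \<in> verts C" for w
  proof -
    obtain j where j: "w = f j" "j \<le> k" using \<open>w \<in> verts C\<close> by (auto simp: C_def)
    define pj where "pj = (if j = 0 then k else j - 1)"
    \<comment> \<open>The edge leaving and the edge entering position \<open>j\<close> each contribute one end. They are the
      same edge when the path has length \<open>0\<close>, and the count is then 2 from a single loop.\<close>
    have cnt: "card {h. attach G (\<epsilon> i) h = Some w} = (if i = j then 1 else 0) + (if i = pj then 1 else 0)"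
      if i: "i \<le> k" for i
    proof -
      obtain a b where ab: "attach G (\<epsilon> i) End1 = Some a" "attach G (\<epsilon> i) End2 = Some b"
        "{a, b} = {f i, f (nx i)}"
        using conjunct1[OF ed[OF i]] conjunct2[OF ed[OF i]] noouter[OF i]
        by (cases rule: edge_cases[of "\<epsilon> i"]) auto
      have hs: "{h. attach G (\<epsilon> i) h = Some w} =
          (if a = w then {End1} else {}) \<union> (if b = w then {End2} else {})"
        using ab UNIV_edge_end by (auto, metis edge_end.exhaust option.inject)+
      have "i = j \<longleftrightarrow> f i = w" using feq[OF i j(2)] j by simp
      moreover have "i = pj \<longleftrightarrow> f (nx i) = w"
        using feq[OF nxk[OF i] j(2)] j i by (auto simp: nx_def pj_def)
      ultimately show ?thesis
        using ab(3) hs by (auto simp: doubleton_eq_iff)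
    qed
    have "{(e', h). e' \<in> edges C \<and> attach C e' h = Some w} =
        Sigma (\<epsilon> ` {..k}) (\<lambda>e'. {h. attach G e' h = Some w})"
      by (auto simp: C_def)
    then have "sg_degree C w = (\<Sum>e'\<in>\<epsilon> ` {..k}. card {h. attach G e' h = Some w})"
      unfolding sg_degree_def
      by (simp add: card_SigmaI finite_subset[OF subset_UNIV] UNIV_edge_end)
    also have "\<dots> = (\<Sum>i\<le>k. (if i = j then 1 else 0) + (if i = pj then 1 else 0))"
      by (subst sum.reindex[OF inj]) (simp add: cnt)
    also have "\<dots> = 2"
      using j(2) unfolding sum.distrib by (auto simp: pj_def)
    finally show ?thesis .
  qed
  moreover have "sg_connected C"
  proof -
    have edge: "(f i, f (nx i)) \<in> adj_rel C" if "i \<le> k" for i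
      using ed[OF that] that by (auto simp: adj_rel_def C_def endpoints_def intro!: bexI[of _ "\<epsilon> i"])
    have reach: "(f 0, f i) \<in> (adj_rel C)\<^sup>*" if "i \<le> k" for i
      using that
    proof (induction i)
      case (Suc i)
      then show ?case using edge[of i] by (auto simp: nx_def intro: rtrancl_into_rtrancl)
    qed simp
    have "sym (adj_rel C)" by (auto simp: sym_def adj_rel_def insert_commute)
    then have "sym ((adj_rel C)\<^sup>*)" by (rule sym_rtrancl)
    then have "(f i, f j) \<in> (adj_rel C)\<^sup>*" if "i \<le> k" "j \<le> k" for i j
      using reach[OF that(1)] reach[OF that(2)] by (meson rtrancl_trans symD)
    then show ?thesis by (auto simp: sg_connected_def C_def)
  qed
  moreover have "\<not> is_outer C e'" if "e' \<in> edges C" for e'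
    using that noouter by (auto simp: C_def is_outer_def)
  moreover have "e \<in> edges C" by (auto simp: C_def \<epsilon>_def image_iff intro!: bexI[of _ k])
  ultimately show ?thesis using sub that by (auto simp: is_circle_def)
qed

text \<open>
  A circle through the only edge that is negative after switching has negative sign after
  switching, hence also before.
\<close>

lemma unbalanced_if_one_switched_negative:
  assumes e: "e \<in> edges G" "\<not> is_outer G e" "switch_sign G n e = -1"
    and conn: "sg_connected (del_edges G {e})"
    and pos: "\<And>e'. e' \<in> edges G - {e} \<Longrightarrow> switch_sign G n e' = 1"
    and n: "\<And>v. v \<in> verts G \<Longrightarrow> n v \<in> {1, -1}"
  shows "\<not> balanced G"
proof -
  obtain C where C: "is_subgraph C G" "is_circle C" "e \<in> edges C"
    using circle_through_edge[OF e(1,2) conn] .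
  have sub: "edges C \<subseteq> edges G" using C by (simp add: is_subgraph_def)
  then have fin: "finite (edges C)" using finite_edges finite_subset by blast
  have "(\<Prod>e\<in>edges C. esign C e) = (\<Prod>e\<in>edges C. switch_sign G n e)"
    using prod_switch_sign_circle[OF C(1,2) n] by simp
  also have "\<dots> = switch_sign G n e * (\<Prod>e'\<in>edges C - {e}. switch_sign G n e')"
    using fin C(3) by (simp add: prod.remove)
  also have "(\<Prod>e'\<in>edges C - {e}. switch_sign G n e') = 1"
    using pos sub by (intro prod.neutral) auto
  finally show ?thesis using e(3) C by (auto simp: balanced_def)
qed

section \<open>Cuts and supports of tensions\<close>

lemma cut_set_eq_coboundary_support:
  assumes X: "X \<subseteq> verts G" and n: "is_switching_on G X n"
  shows "cut_set G X n =
    chain_support G (coboundary G (\<lambda>v. if v \<in> X then n v else 0))"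
proof -
  have "e \<in> cut_set G X n \<longleftrightarrow>
      coboundary G (\<lambda>v. if v \<in> X then n v else 0) (e, std_orientation G e) \<noteq> 0"
    if e: "e \<in> edges G" for e
    using e
  proof (cases rule: edge_cases)
    case (ends u v)
    have "n u \<in> {1, -1}" "n v \<in> {1, -1}" "esign G e \<in> {1, -1}"
      using n ends esign_cases[OF e] by (auto simp: is_switching_on_def)
    then show ?thesis
      using ends e X
      by (auto simp: cut_set_def links_between_def induced_def outer_edges_at_def switch_def
            switch_sign_def coboundary_std is_link_def is_loop_def doubleton_eq_iff)
  next
    case (outer u)
    have "n u \<in> {1, -1}" "esign G e \<in> {1, -1}"
      using n outer esign_cases[OF e] by (auto simp: is_switching_on_def)
    then show ?thesis
      using outer e X
      by (auto simp: cut_set_def links_between_def induced_def outer_edges_at_def switch_def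
            switch_sign_def coboundary_std is_link_def is_loop_def)
  qed
  moreover have "cut_set G X n \<subseteq> edges G"
    by (auto simp: cut_set_def links_between_def induced_def outer_edges_at_def)
  moreover have "is_chain G (coboundary G (\<lambda>v. if v \<in> X then n v else 0))"
    using coboundary_is_tension is_tension_def by blast
  ultimately show ?thesis by (auto simp: chain_support_std)
qed

text \<open>
  Connectedness of \<open>\<Sigma>[X] - U\<close> secures the maximality condition in the definition of a cut. A negative
  edge that joins two components of a switched-positive graph would leave it balanced.
\<close>

lemma cut_set_is_cut:
  assumes X: "X \<subseteq> verts G" and n: "is_switching_on G X n"
    and ne: "cut_set G X n \<noteq> {}"
    and conn: "sg_connected (del_edges (induced G X) (cut_set G X n))"
  shows "is_cut G (cut_set G X n)"
proof -
  let ?U = "cut_set G X n"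
  let ?H = "del_edges (induced G X) ?U"
  have nv: "n v \<in> {1, -1}" if "v \<in> X" for v
    using n X that by (auto simp: is_switching_on_def)
  have indE: "e \<in> edges G \<and> \<not> is_outer G e \<and> endpoints G e \<subseteq> X \<and> switch_sign G n e \<in> {1, -1}"
    if "e \<in> edges (induced G X)" for e
  proof -
    have "e \<in> edges G" "is_loop G e \<or> is_link G e" "endpoints G e \<subseteq> X"
      using that by (auto simp: induced_def)
    moreover from this(1) have "switch_sign G n e \<in> {1, -1} \<and> \<not> is_outer G e"
    proof (cases rule: edge_cases)
      case (ends u v)
      then have "n u \<in> {1, -1}" "n v \<in> {1, -1}" "esign G e \<in> {1, -1}"
        using n esign_cases[of e] \<open>e \<in> edges G\<close> by (auto simp: is_switching_on_def)
      then show ?thesis using ends by (auto simp: switch_sign_def)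
    next
      case (outer u)
      then show ?thesis using calculation by (auto simp: is_loop_def is_link_def)
    qed
    ultimately show ?thesis by auto
  qed
  have U: "e \<in> ?U \<longleftrightarrow> switch_sign G n e = -1" if "e \<in> edges (induced G X)" for e
    using that indE[OF that] X
    by (auto simp: cut_set_def links_between_def outer_edges_at_def switch_def)
  have signed: "signed_graph K"
    if "verts K = X" "edges K \<subseteq> edges (induced G X)" "attach K = attach G" "esign K = esign G" for K :: "('v, 'e) sgraph"
  proof -
    have "endpoints K = endpoints G" using that by (auto simp: endpoints_def fun_eq_iff)
    moreover have "finite X" "finite (edges (induced G X))"
      using X finite_verts finite_edges by (auto simp: induced_def intro: finite_subset)
    ultimately show ?thesis
      using that(1,3,4) indE subsetD[OF that(2)] finite_subset[OF that(2)]
        some_end_attached esign_cases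
      by unfold_locales (metis | blast)+
  qed
  have sw: "switch_sign K n = switch_sign G n" "is_outer K = is_outer G"
    if "attach K = attach G" "esign K = esign G" for K :: "('v, 'e) sgraph"
    using that by (intro ext; simp add: switch_sign_def is_outer_def cong: option.case_cong)+
  have H: "switch_sign ?H n = switch_sign G n" "is_outer ?H = is_outer G"
    by (rule sw; simp add: del_edges_def induced_def)+
  have "balanced ?H"
  proof (rule signed_graph.balanced_if_switched_positive)
    show "signed_graph ?H" by (rule signed) (auto simp: del_edges_def induced_def)
    fix e assume "e \<in> edges ?H"
    then have "e \<in> edges (induced G X)" "e \<notin> ?U" by (auto simp: del_edges_def)
    then show "\<not> is_outer ?H e \<and> switch_sign ?H n e = 1"
      using H U[of e] indE[of e] by auto
  qed (use nv in \<open>auto simp: del_edges_def induced_def\<close>)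
  moreover have "\<not> balanced (add_edge ?H e)" if e: "e \<in> edges (induced G X) \<inter> ?U" for e
  proof (rule signed_graph.unbalanced_if_one_switched_negative)
    let ?K = "add_edge ?H e"
    have K: "verts ?K = X" "edges ?K = insert e (edges (induced G X) - ?U)"
      "attach ?K = attach G" "esign ?K = esign G"
      by (auto simp: add_edge_def del_edges_def induced_def)
    show "signed_graph ?K" by (rule signed) (use K e in auto)
    have "del_edges ?K {e} = ?H" using e by (auto simp: add_edge_def del_edges_def)
    then show "sg_connected (del_edges ?K {e})" using conn by simp
    show "e \<in> edges ?K" using K by simp
    show "\<not> is_outer ?K e" "switch_sign ?K n e = -1"
      using sw[of ?K] K e indE[of e] U[of e] by auto
    show "switch_sign ?K n e' = 1" if "e' \<in> edges ?K - {e}" for e'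
      using sw[of ?K] K that indE[of e'] U[of e'] by auto
    show "n v \<in> {1, -1}" if "v \<in> verts ?K" for v using nv K that by simp
  qed
  moreover have "X \<noteq> {}" using conn by (simp add: sg_connected_def del_edges_def induced_def)
  moreover have "\<forall>e\<in>edges (induced G X) \<inter> ?U. esign (switch G n) e = -1"
    "\<forall>e\<in>edges (induced G X) - ?U. esign (switch G n) e = 1"
    using U indE by (auto simp: switch_def)
  ultimately show ?thesis
    unfolding is_cut_def using ne X n by blast
qed

text \<open>
  An empty \<open>\<delta>X\<^sup>\<nu>\<close> means that no edge leaves \<open>X\<close> and that \<open>\<nu>\<close> makes the part of the graph on \<open>X\<close> positive:
  by connectedness \<open>X = V\<close>, and then the whole graph is balanced.
\<close>

lemma cut_set_nonempty:
  assumes conn: "sg_connected G" and unb: "\<not> balanced G"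
    and X: "X \<subseteq> verts G" "X \<noteq> {}" and n: "is_switching_on G X n"
  shows "cut_set G X n \<noteq> {}"
proof (cases "X = verts G")
  case True
  show ?thesis
  proof
    assume empty: "cut_set G X n = {}"
    have nv: "n v \<in> {1, -1}" if "v \<in> verts G" for v
      using n that by (auto simp: is_switching_on_def)
    have "\<not> is_outer G e \<and> switch_sign G n e = 1" if e: "e \<in> edges G" for e
      using e
    proof (cases rule: edge_cases)
      case (ends u v)
      then have "e \<in> edges (induced G X)"
        using e True by (auto simp: induced_def is_loop_def is_link_def)
      then have "switch_sign G n e \<noteq> -1"
        using empty by (auto simp: cut_set_def switch_def)
      then show ?thesis
        using ends nv[of u] nv[of v] esign_cases[OF e] by (auto simp: switch_sign_def)
    next
      case (outer u)
      then have "e \<in> outer_edges_at G X" using e True by (auto simp: outer_edges_at_def)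
      then show ?thesis using empty by (auto simp: cut_set_def)
    qed
    then show False using balanced_if_switched_positive[of n] nv unb by blast
  qed
next
  case False
  then obtain x y where xy: "x \<in> X" "y \<in> verts G - X" using X by auto
  then have "(x, y) \<in> (adj_rel G)\<^sup>*" using conn X by (auto simp: sg_connected_def)
  then have "\<exists>a b. a \<in> X \<and> b \<notin> X \<and> (a, b) \<in> adj_rel G"
    using xy by (induction rule: converse_rtrancl_induct) auto
  then obtain a b e where ab: "a \<in> X" "b \<notin> X" "e \<in> edges G" "endpoints G e = {a, b}"
    by (auto simp: adj_rel_def)
  then have "b \<in> verts G" using endpoints_in_verts by blast
  moreover have "is_link G e"
    using ab(3)
  proof (cases rule: edge_cases)
    case (ends u v)
    then have "u \<noteq> v" using ab by (auto simp: doubleton_eq_iff)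
    then show ?thesis using ends by (auto simp: is_link_def)
  qed (use ab in auto)
  ultimately have "e \<in> links_between G X (verts G - X)"
    using ab by (auto simp: links_between_def)
  then show ?thesis by (auto simp: cut_set_def)
qed

text \<open>
  The vertex set \<open>X\<close> of the cut is one component of the links on which the tension vanishes. Taking
  all vertices where the potential has a given nonzero absolute value would give a set \<open>\<delta>X\<^sup>\<nu>\<close> inside the
  support too, but possibly a disconnected \<open>\<Sigma>[X] - \<delta>X\<^sup>\<nu>\<close>, and then \<open>\<delta>X\<^sup>\<nu>\<close> need not satisfy the
  definition of a cut.
\<close>

lemma tension_support_contains_cut:
  fixes g :: "'e arc \<Rightarrow> real"
  assumes conn: "sg_connected G" and unb: "\<not> balanced G"
    and g: "is_tension G g" "nonzero_chain G g"
  obtains U where "is_cut G U" "U \<subseteq> chain_support G g"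
proof -
  obtain p where p: "\<And>e. e \<in> edges G \<Longrightarrow>
      g (e, std_orientation G e) = coboundary G p (e, std_orientation G e)"
    using real_tension_is_coboundary[OF g(1)] by blast
  have supp: "chain_support G g = {e \<in> edges G. coboundary G p (e, std_orientation G e) \<noteq> 0}"
    using chain_support_std g(1) p by (auto simp: is_tension_def)
  have "\<exists>v0\<in>verts G. p v0 \<noteq> 0"
  proof (rule ccontr)
    assume "\<not> (\<exists>v0\<in>verts G. p v0 \<noteq> 0)"
    then have "chain_support G g = {}" by (simp add: supp coboundary_def)
    then show False using g(2) nonzero_chain_iff_support by blast
  qed
  then obtain v0 where v0: "v0 \<in> verts G" "p v0 \<noteq> 0" by auto
  define R where "R = {(u, v). \<exists>e\<in>edges G - chain_support G g. is_link G e \<and> endpoints G e = {u, v}}"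
  define X where "X = R\<^sup>* `` {v0}"
  define n :: "'v \<Rightarrow> int" where "n v = (if v \<in> X \<and> p v < 0 then -1 else 1)" for v
  have Rabs: "\<bar>p u\<bar> = \<bar>p v\<bar> \<and> v \<in> verts G" if uv: "(u, v) \<in> R" for u v
  proof -
    obtain e where e: "e \<in> edges G" "e \<notin> chain_support G g" "is_link G e" "endpoints G e = {u, v}"
      using uv by (auto simp: R_def)
    obtain a b where ab: "attach G e End1 = Some a" "attach G e End2 = Some b"
        "endpoints G e = {a, b}"
      using e by (auto simp: is_link_def endpoints_def ex_edge_end)
    have "p a = of_int (esign G e) * p b"
      using e ab by (simp add: supp coboundary_std)
    then have "\<bar>p a\<bar> = \<bar>p b\<bar>" using esign_cases[OF e(1)] by auto
    then show ?thesis using ab e endpoints_in_verts[OF e(1)] by (auto simp: doubleton_eq_iff)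
  qed
  have Xp: "v \<in> verts G \<and> \<bar>p v\<bar> = \<bar>p v0\<bar>" if "v \<in> X" for v
  proof -
    have "(v0, v) \<in> R\<^sup>*" using that by (simp add: X_def)
    then show ?thesis by (induction rule: rtrancl_induct) (use v0 Rabs in auto)
  qed
  have v0X: "v0 \<in> X" by (simp add: X_def)
  have closed: "v \<in> X" if "u \<in> X" "(u, v) \<in> R" for u v
    using that by (auto simp: X_def intro: rtrancl_into_rtrancl)
  have symR: "sym R" by (auto simp: sym_def R_def insert_commute)
  have XV: "X \<subseteq> verts G" using Xp by auto
  have sw: "is_switching_on G X n" by (auto simp: is_switching_on_def n_def)
  have pn: "p v = of_int (n v) * \<bar>p v0\<bar>" if "v \<in> X" for v
    using Xp[OF that] that by (auto simp: n_def)
  \<comment> \<open>Inside \<open>X\<close>, \<open>p\<close> is a nonzero multiple of \<open>n\<close>; so the two coboundaries vanish on the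
    same edges there.\<close>
  have inner: "e \<in> cut_set G X n \<longleftrightarrow> e \<in> chain_support G g"
    if e: "e \<in> edges G" "endpoints G e \<subseteq> X" for e
  proof -
    let ?q = "\<lambda>v. if v \<in> X then n v else 0"
    have "coboundary G p (e, std_orientation G e) =
        of_int (coboundary G ?q (e, std_orientation G e)) * \<bar>p v0\<bar>"
      using e(2) pn
      by (auto simp: coboundary_std[OF e(1)] endpoints_iff subset_iff algebra_simps split: option.splits)
    moreover have "is_chain G (coboundary G ?q)"
      using coboundary_is_tension is_tension_def by blast
    ultimately show ?thesis
      using v0 e by (simp add: cut_set_eq_coboundary_support[OF XV sw] chain_support_std supp)
  qed
  have "cut_set G X n \<subseteq> chain_support G g"
  proof
    fix e assume e: "e \<in> cut_set G X n"
    show "e \<in> chain_support G g"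
    proof (cases "e \<in> links_between G X (verts G - X)")
      case True
      then obtain x y where "x \<in> X" "y \<notin> X" "e \<in> edges G" "is_link G e" "endpoints G e = {x, y}"
        by (auto simp: links_between_def)
      then show ?thesis using closed[of x y] by (auto simp: R_def)
    next
      case False
      then have "e \<in> edges G" "endpoints G e \<subseteq> X"
        using e by (auto simp: cut_set_def induced_def outer_edges_at_def)
      then show ?thesis using inner e by blast
    qed
  qed
  moreover have "is_cut G (cut_set G X n)"
  proof (rule cut_set_is_cut[OF XV sw])
    show "cut_set G X n \<noteq> {}" using cut_set_nonempty[OF conn unb XV _ sw] v0X by auto
    let ?H = "del_edges (induced G X) (cut_set G X n)"
    have step: "(u, v) \<in> adj_rel ?H" if u: "u \<in> X" and uv: "(u, v) \<in> R" for u v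
    proof -
      obtain e where e: "e \<in> edges G" "e \<notin> chain_support G g" "is_link G e" "endpoints G e = {u, v}"
        using uv by (auto simp: R_def)
      then have sub: "endpoints G e \<subseteq> X" using u uv closed by auto
      then have "e \<notin> cut_set G X n" using inner e by auto
      then have "e \<in> edges ?H" using e sub by (auto simp: del_edges_def induced_def)
      moreover have "endpoints ?H e = {u, v}"
        using e by (simp add: endpoints_def del_edges_def induced_def)
      ultimately show ?thesis by (auto simp: adj_rel_def)
    qed
    have reach: "v \<in> X \<and> (u, v) \<in> (adj_rel ?H)\<^sup>*" if "(u, v) \<in> R\<^sup>*" "u \<in> X" for u v
      using that
      by (induction rule: rtrancl_induct) (auto intro: closed step rtrancl_into_rtrancl)
    have "(u, v) \<in> R\<^sup>*" if "u \<in> X" "v \<in> X" for u v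
    proof -
      have "(v0, u) \<in> R\<^sup>*" "(v0, v) \<in> R\<^sup>*" using that by (auto simp: X_def)
      then show ?thesis by (rule rtrancl_trans[OF symD[OF sym_rtrancl[OF symR]]])
    qed
    then have "\<forall>u\<in>X. \<forall>v\<in>X. (u, v) \<in> (adj_rel ?H)\<^sup>*"
      using reach by blast
    moreover have "verts ?H = X" by (simp add: del_edges_def induced_def)
    ultimately show "sg_connected ?H"
      using v0X unfolding sg_connected_def by (metis empty_iff)
  qed
  ultimately show ?thesis using that by blast
qed

lemma cut_is_tension_support:
  assumes "is_cut G U"
  obtains g :: "'e arc \<Rightarrow> int" where "is_tension G g" "nonzero_chain G g" "U = chain_support G g"
proof -
  obtain X n where "X \<subseteq> verts G" "is_switching_on G X n" "U = cut_set G X n" and ne: "U \<noteq> {}"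
    using assms by (auto simp: is_cut_def)
  then have "U = chain_support G (coboundary G (\<lambda>v. if v \<in> X then n v else 0))"
    using cut_set_eq_coboundary_support by simp
  then show ?thesis using that coboundary_is_tension ne nonzero_chain_iff_support by metis
qed

lemma real_of_integer_tension:
  fixes g :: "'e arc \<Rightarrow> int"
  assumes "is_tension G g"
  shows "is_tension G (\<lambda>a. real_of_int (g a))"
    and "chain_support G (\<lambda>a. real_of_int (g a)) = chain_support G g"
proof -
  have "(\<Sum>e\<in>edges G. real_of_int (f (e, w e)) * real_of_int (g (e, w e))) =
      real_of_int (\<Sum>e\<in>edges G. f (e, w e) * g (e, w e))" for f :: "'e arc \<Rightarrow> int" and w
    by simp
  then show "is_tension G (\<lambda>a. real_of_int (g a))"
    using assms unfolding is_tension_def is_chain_def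
    by (simp del: of_int_sum of_int_mult add: of_int_sum[symmetric] of_int_mult[symmetric])
qed (simp add: chain_support_def)

end

theorem theorem4p8:
  fixes G :: "('v, 'e) sgraph" and U :: "'e set"
  assumes "signed_graph G"
    and "sg_connected G"
    and "\<not> balanced G"
    and "U \<subseteq> edges G"
  shows "is_bond G U \<longleftrightarrow>
    (\<exists>g :: 'e arc \<Rightarrow> int. elementary_tension G g \<and> U = chain_support G g)"
proof -
  interpret signed_graph G by fact
  have contains: "\<exists>U'. is_cut G U' \<and> U' \<subseteq> chain_support G g"
    if "is_tension G g" "nonzero_chain G g" for g :: "'e arc \<Rightarrow> real"
    using tension_support_contains_cut[OF assms(2,3) that] by blast
  have realize: "\<exists>g :: 'e arc \<Rightarrow> real. is_tension G g \<and> nonzero_chain G g \<and> chain_support G g = U'"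
    if "is_cut G U'" for U'
    using cut_is_tension_support[OF that] real_of_integer_tension nonzero_chain_iff_support by metis
  show ?thesis
  proof
    assume bond: "is_bond G U"
    then obtain g :: "'e arc \<Rightarrow> int" where g: "is_tension G g" "nonzero_chain G g" "U = chain_support G g"
      using cut_is_tension_support by (auto simp: is_bond_def)
    have "\<not> chain_support G g' \<subset> U" if "is_tension G g'" "nonzero_chain G g'" for g' :: "'e arc \<Rightarrow> real"
      using contains[OF that] bond unfolding is_bond_def by (meson subset_psubset_trans)
    then show "\<exists>g :: 'e arc \<Rightarrow> int. elementary_tension G g \<and> U = chain_support G g"
      using g by (auto simp: elementary_tension_def)
  next
    assume "\<exists>g :: 'e arc \<Rightarrow> int. elementary_tension G g \<and> U = chain_support G g"
    then obtain g :: "'e arc \<Rightarrow> int" where g: "is_tension G g" "nonzero_chain G g" "U = chain_support G g"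
      and min: "\<And>g' :: 'e arc \<Rightarrow> real. is_tension G g' \<Longrightarrow> nonzero_chain G g' \<Longrightarrow> \<not> chain_support G g' \<subset> U"
      by (auto simp: elementary_tension_def)
    have no_smaller: "\<not> U' \<subset> U" if "is_cut G U'" for U'
      using realize[OF that] min by blast
    have "nonzero_chain G (\<lambda>a. real_of_int (g a))"
      using g(2) by (simp add: nonzero_chain_def)
    then obtain U' where "is_cut G U'" "U' \<subseteq> U"
      using contains real_of_integer_tension[OF g(1)] g(3) by metis
    then have "is_cut G U" using no_smaller by (metis psubsetI)
    then show "is_bond G U" using no_smaller by (simp add: is_bond_def)
  qed
qed

end
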